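(* Let $(A,\cdot,\{\,,\})$ be a Poisson superalgebra with an even derivation $D$ of $(A,\cdot)$ such that $P=D+\mathrm{Id}$ is a derivation of the Lie superalgebra $(A,\{\,,\})$. Then $(A,\cdot,\{\,,\},P)$ is a quasi-Poisson superalgebra.
   Context: All vector spaces are over $\mathbb{C}$; $p(x)\in\{0,1\}$ denotes the parity of a homogeneous element $x$, and identities are stated for parity-homogeneous elements. A Poisson superalgebra here has a supercommutative associative unital product $\cdot$ and an (even) Lie superbracket $\{\,,\}$ satisfying the super Leibniz rule $\{a,b\cdot c\}=\{a,b\}\cdot c+(-1)^{p(a)p(b)}b\cdot\{a,c\}$. A quasi-Poisson superalgebra is a $\mathbb{Z}_2$-graded space $A$ with two bilinear operations $\cdot$ and $\{\,,\}$ and an even endomorphism $P\in\mathrm{End}(A)$ such that: (QP1) $(A,\cdot)$ is a (super)commutative associative unital superalgebra; (QP2) $(A,\{\,,\})$ is a Lie superalgebra; (QP3) $P(a\cdot b)=P(a)\cdot b+a\cdot P(b)-a\cdot b$ for all $a,b\in A$; (QP4) for all $a,b,c\in A$, $$a\cdot P(\{b,c\})=\{a\cdot P(b),c\}+(-1)^{p(a)p(b)}\{b,a\cdot P(c)\}+\{a,b\}\cdot P(c)-(-1)^{p(a)p(b)}P(b)\cdot\{a,c\}.$$ *)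

theory Defs
  imports Complex_Main "HOL-Library.Z2"
begin

definition ksign :: "bit \<Rightarrow> bit \<Rightarrow> complex" where
  "ksign i j = (if i * j = 1 then -1 else 1)"

text \<open>
  The underlying space is the whole type \<open>'a\<close>, of arbitrary dimension; \<open>A 0\<close> and \<open>A 1\<close> are its
  even and odd parts. There is no parity function, since \<open>0\<close> is homogeneous of both parities:
  \<open>a \<in> A i\<close> says that \<open>a\<close> is homogeneous and may be given the parity \<open>i\<close>.
\<close>

locale superspace = vector_space scale
  for scale :: "complex \<Rightarrow> 'a::ab_group_add \<Rightarrow> 'a" (infixr "*s" 75) +
  fixes A :: "bit \<Rightarrow> 'a set"
  assumes subspace_part: "subspace (A i)"
    and parts_disjoint: "A 0 \<inter> A 1 = {0}"
    and parts_span: "\<exists>a\<in>A 0. \<exists>b\<in>A 1. x = a + b"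

locale superalgebra = superspace scale A
  for scale :: "complex \<Rightarrow> 'a::ab_group_add \<Rightarrow> 'a" (infixr "*s" 75)
    and A :: "bit \<Rightarrow> 'a set" +
  fixes mul :: "'a \<Rightarrow> 'a \<Rightarrow> 'a"
  assumes linear_left: "Vector_Spaces.linear scale scale (\<lambda>a. mul a b)"
    and linear_right: "Vector_Spaces.linear scale scale (\<lambda>b. mul a b)"
    and graded: "\<lbrakk>a \<in> A i; b \<in> A j\<rbrakk> \<Longrightarrow> mul a b \<in> A (i + j)"

locale comm_assoc_unital_superalgebra = superalgebra scale A mul
  for scale :: "complex \<Rightarrow> 'a::ab_group_add \<Rightarrow> 'a" (infixr "*s" 75)
    and A :: "bit \<Rightarrow> 'a set"
    and mul :: "'a \<Rightarrow> 'a \<Rightarrow> 'a" (infixl "\<cdot>" 70) +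
  assumes supercommutative: "\<lbrakk>a \<in> A i; b \<in> A j\<rbrakk> \<Longrightarrow> a \<cdot> b = ksign i j *s (b \<cdot> a)"
    and associative: "(a \<cdot> b) \<cdot> c = a \<cdot> (b \<cdot> c)"
    and unital: "\<exists>e. \<forall>a. e \<cdot> a = a \<and> a \<cdot> e = a"

locale lie_superalgebra = superalgebra scale A br
  for scale :: "complex \<Rightarrow> 'a::ab_group_add \<Rightarrow> 'a" (infixr "*s" 75)
    and A :: "bit \<Rightarrow> 'a set"
    and br :: "'a \<Rightarrow> 'a \<Rightarrow> 'a" ("\<lbrace>_,_\<rbrace>") +
  assumes super_skew: "\<lbrakk>a \<in> A i; b \<in> A j\<rbrakk> \<Longrightarrow> \<lbrace>a,b\<rbrace> = - (ksign i j *s \<lbrace>b,a\<rbrace>)"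
    and super_jacobi: "\<lbrakk>a \<in> A i; b \<in> A j; c \<in> A k\<rbrakk> \<Longrightarrow>
      \<lbrace>a,\<lbrace>b,c\<rbrace>\<rbrace> = \<lbrace>\<lbrace>a,b\<rbrace>,c\<rbrace> + ksign i j *s \<lbrace>b,\<lbrace>a,c\<rbrace>\<rbrace>"

locale poisson_superalgebra =
  comm_assoc_unital_superalgebra scale A mul + lie: lie_superalgebra scale A br
  for scale :: "complex \<Rightarrow> 'a::ab_group_add \<Rightarrow> 'a" (infixr "*s" 75)
    and A :: "bit \<Rightarrow> 'a set"
    and mul :: "'a \<Rightarrow> 'a \<Rightarrow> 'a" (infixl "\<cdot>" 70)
    and br :: "'a \<Rightarrow> 'a \<Rightarrow> 'a" ("\<lbrace>_,_\<rbrace>") +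
  assumes super_leibniz: "\<lbrakk>a \<in> A i; b \<in> A j; c \<in> A k\<rbrakk> \<Longrightarrow>
      \<lbrace>a, b \<cdot> c\<rbrace> = \<lbrace>a,b\<rbrace> \<cdot> c + ksign i j *s (b \<cdot> \<lbrace>a,c\<rbrace>)"

definition even_endomorphism ::
    "(complex \<Rightarrow> 'a::ab_group_add \<Rightarrow> 'a) \<Rightarrow> (bit \<Rightarrow> 'a set) \<Rightarrow> ('a \<Rightarrow> 'a) \<Rightarrow> bool" where
  "even_endomorphism scale A f \<longleftrightarrow>
     Vector_Spaces.linear scale scale f \<and> (\<forall>i. f ` A i \<subseteq> A i)"

text \<open>
  A derivation of the algebra with product \<open>mul\<close> (which may be a Lie superbracket). The sign
  in the super Leibniz rule of \<open>D\<close> is trivial because \<open>D\<close> is even.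
\<close>

definition even_derivation ::
    "(complex \<Rightarrow> 'a::ab_group_add \<Rightarrow> 'a) \<Rightarrow> (bit \<Rightarrow> 'a set) \<Rightarrow> ('a \<Rightarrow> 'a \<Rightarrow> 'a) \<Rightarrow>
     ('a \<Rightarrow> 'a) \<Rightarrow> bool" where
  "even_derivation scale A mul D \<longleftrightarrow>
     even_endomorphism scale A D \<and> (\<forall>a b. D (mul a b) = mul (D a) b + mul a (D b))"

locale quasi_poisson_superalgebra =
  comm_assoc_unital_superalgebra scale A mul + lie: lie_superalgebra scale A br
  for scale :: "complex \<Rightarrow> 'a::ab_group_add \<Rightarrow> 'a" (infixr "*s" 75)
    and A :: "bit \<Rightarrow> 'a set"
    and mul :: "'a \<Rightarrow> 'a \<Rightarrow> 'a" (infixl "\<cdot>" 70)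
    and br :: "'a \<Rightarrow> 'a \<Rightarrow> 'a" ("\<lbrace>_,_\<rbrace>") +
  fixes P :: "'a \<Rightarrow> 'a"
  assumes P_even: "even_endomorphism scale A P"
    and QP3: "P (a \<cdot> b) = P a \<cdot> b + a \<cdot> P b - a \<cdot> b"
    and QP4: "\<lbrakk>a \<in> A i; b \<in> A j; c \<in> A k\<rbrakk> \<Longrightarrow>
      a \<cdot> P \<lbrace>b,c\<rbrace> = \<lbrace>a \<cdot> P b, c\<rbrace> + ksign i j *s \<lbrace>b, a \<cdot> P c\<rbrace>
                  + \<lbrace>a,b\<rbrace> \<cdot> P c - ksign i j *s (P b \<cdot> \<lbrace>a,c\<rbrace>)"

end

theory Submission
  imports Defs
begin

text \<open>
  Expanding \<open>{a \<cdot> P(b), c}\<close> and \<open>{b, a \<cdot> P(c)}\<close> by the two super Leibniz rules gives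
  \<open>a \<cdot> {P(b), c} + a \<cdot> {b, P(c)}\<close>, which is \<open>a \<cdot> P({b,c})\<close> because \<open>P\<close> is a derivation of the
  bracket, plus two terms that the remaining summands of (QP4) cancel. The terms are cancelled
  for any \<open>b', c'\<close> of the parities of \<open>b, c\<close>, so only the evenness of \<open>P\<close> enters there.
\<close>

lemma ksign_commute: "ksign i j = ksign j i"
  by (simp add: ksign_def mult.commute)

lemma ksign_square [simp]: "ksign i j * ksign i j = 1"
  by (simp add: ksign_def)

text \<open>Splits the signs that arise when a product or bracket, whose parity is the sum of the
  parities of its factors, passes another element.\<close>

lemma ksign_add_left: "ksign (i + j) k = ksign i k * ksign j k"
  by (cases i; cases j; cases k) (simp_all add: ksign_def)

context superalgebra
begin

lemma mul_add_left: "mul (a + b) c = mul a c + mul b c"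
  using linear_left[of c] by (rule module_hom.add[OF linear_iff_module_hom[THEN iffD1]])

lemma mul_add_right: "mul a (b + c) = mul a b + mul a c"
  using linear_right[of a] by (rule module_hom.add[OF linear_iff_module_hom[THEN iffD1]])

lemma mul_scale_left: "mul (r *s a) b = r *s mul a b"
  using linear_left[of b] by (rule module_hom.scale[OF linear_iff_module_hom[THEN iffD1]])

lemma mul_scale_right: "mul a (r *s b) = r *s mul a b"
  using linear_right[of a] by (rule module_hom.scale[OF linear_iff_module_hom[THEN iffD1]])

lemma mul_minus_left: "mul (- a) b = - mul a b"
  using mul_scale_left[of "-1" a b] by simp

lemma mul_minus_right: "mul a (- b) = - mul a b"
  using mul_scale_right[of a "-1" b] by simp

end

context poisson_superalgebra
begin

text \<open>Super skew-symmetry moves the product into the second slot, where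
  \<open>super_leibniz\<close> applies; flipping both resulting brackets back leaves only signs to
  collect.\<close>

lemma super_leibniz_left:
  assumes a: "a \<in> A i" and b: "b \<in> A j" and c: "c \<in> A k"
  shows "\<lbrace>a \<cdot> b, c\<rbrace> = a \<cdot> \<lbrace>b,c\<rbrace> + ksign i j *s (b \<cdot> \<lbrace>a,c\<rbrace>)"
proof -
  have ca: "\<lbrace>c,a\<rbrace> = - (ksign k i *s \<lbrace>a,c\<rbrace>)" and cb: "\<lbrace>c,b\<rbrace> = - (ksign k j *s \<lbrace>b,c\<rbrace>)"
    using a b c by (auto intro: lie.super_skew)
  \<comment> \<open>The bracket has parity \<open>i + k\<close>, which fixes the sign for moving it
    past \<open>b\<close>.\<close>
  have acb: "\<lbrace>a,c\<rbrace> \<cdot> b = (ksign i j * ksign k j) *s (b \<cdot> \<lbrace>a,c\<rbrace>)"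
    unfolding ksign_add_left[symmetric] using a b c by (intro supercommutative lie.graded)
  have "\<lbrace>a \<cdot> b, c\<rbrace> = - ((ksign i k * ksign j k) *s \<lbrace>c, a \<cdot> b\<rbrace>)"
    unfolding ksign_add_left[symmetric] using a b c by (intro lie.super_skew graded)
  also have "\<dots> = - ((ksign i k * ksign j k) *s (\<lbrace>c,a\<rbrace> \<cdot> b + ksign k i *s (a \<cdot> \<lbrace>c,b\<rbrace>)))"
    using a b c by (simp add: super_leibniz)
  also have "\<dots> = (ksign i k * ksign j k * ksign k i * (ksign i j * ksign k j)) *s (b \<cdot> \<lbrace>a,c\<rbrace>)
      + (ksign i k * ksign j k * ksign k i * ksign k j) *s (a \<cdot> \<lbrace>b,c\<rbrace>)"
    unfolding ca cb
    by (simp add: acb mul_minus_left mul_minus_right mul_scale_left mul_scale_right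
        scale_right_distrib scale_right_diff_distrib mult_ac)
  \<comment> \<open>The signs for the pairs \<open>i\<close>, \<open>k\<close> and \<open>j\<close>,
    \<open>k\<close> each occur twice and cancel.\<close>
  also have "ksign i k * ksign j k * ksign k i * (ksign i j * ksign k j) = ksign i j"
    by (cases i; cases j; cases k) (simp_all add: ksign_def)
  also have "ksign i k * ksign j k * ksign k i * ksign k j = 1"
    by (cases i; cases j; cases k) (simp_all add: ksign_def)
  finally show ?thesis
    by (simp add: add.commute)
qed

lemma bracket_mul_cancel:
  assumes a: "a \<in> A i" and b: "b \<in> A j" and c: "c \<in> A k"
    and b': "b' \<in> A j" and c': "c' \<in> A k"
  shows "\<lbrace>a \<cdot> b', c\<rbrace> + ksign i j *s \<lbrace>b, a \<cdot> c'\<rbrace> + \<lbrace>a,b\<rbrace> \<cdot> c' - ksign i j *s (b' \<cdot> \<lbrace>a,c\<rbrace>)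
    = a \<cdot> (\<lbrace>b',c\<rbrace> + \<lbrace>b,c'\<rbrace>)"
proof -
  have "\<lbrace>b, a \<cdot> c'\<rbrace> = \<lbrace>b,a\<rbrace> \<cdot> c' + ksign j i *s (a \<cdot> \<lbrace>b,c'\<rbrace>)"
    using b a c' by (rule super_leibniz)
  \<comment> \<open>The Leibniz sign meets the outer sign and squares to 1, so the last term carries
    no sign.\<close>
  then have "ksign i j *s \<lbrace>b, a \<cdot> c'\<rbrace> = ksign i j *s (\<lbrace>b,a\<rbrace> \<cdot> c') + a \<cdot> \<lbrace>b,c'\<rbrace>"
    by (simp add: scale_right_distrib ksign_commute[of j i])
  \<comment> \<open>This is exactly the negative of the unwanted term above; the other unwanted
    term, from \<open>super_leibniz_left\<close>, is removed by the last summand of the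
    goal.\<close>
  moreover have "\<lbrace>a,b\<rbrace> \<cdot> c' = - (ksign i j *s (\<lbrace>b,a\<rbrace> \<cdot> c'))"
    by (simp add: lie.super_skew[OF a b] mul_minus_left mul_scale_left)
  ultimately show ?thesis
    by (simp add: super_leibniz_left[OF a b' c] mul_add_right)
qed

end

theorem lemma6p2:
  fixes scale :: "complex \<Rightarrow> 'a::ab_group_add \<Rightarrow> 'a"
    and A :: "bit \<Rightarrow> 'a set"
    and mul br :: "'a \<Rightarrow> 'a \<Rightarrow> 'a"
    and D P :: "'a \<Rightarrow> 'a"
  assumes "poisson_superalgebra scale A mul br"
    and "even_derivation scale A mul D"
    and "P = (\<lambda>x. D x + x)"
    and "even_derivation scale A br P"
  shows "quasi_poisson_superalgebra scale A mul br P"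
proof -
  interpret poisson_superalgebra scale A mul br by fact
  have P_even: "even_endomorphism scale A P"
    and P_br: "P (br a b) = br (P a) b + br a (P b)" for a b
    using assms(4) by (simp_all add: even_derivation_def)
  have P_mem: "P a \<in> A i" if "a \<in> A i" for a i
    using P_even that by (auto simp: even_endomorphism_def)
  have D_mul: "D (mul a b) = mul (D a) b + mul a (D b)" for a b
    using assms(2) by (simp add: even_derivation_def)
  show ?thesis
  proof
    show "even_endomorphism scale A P" by fact
    \<comment> \<open>The identity part of \<open>P\<close> gives the product once on the left but
      twice in the two Leibniz terms, whence the correction.\<close>
    show "P (mul a b) = mul (P a) b + mul a (P b) - mul a b" for a b
      by (simp add: assms(3) D_mul mul_add_left mul_add_right)
    show "mul a (P (br b c)) = br (mul a (P b)) c + scale (ksign i j) (br b (mul a (P c)))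
        + mul (br a b) (P c) - scale (ksign i j) (mul (P b) (br a c))"
      if "a \<in> A i" "b \<in> A j" "c \<in> A k" for a b c i j k
      \<comment> \<open>Take \<open>b' = P b\<close> and \<open>c' = P c\<close>, which have the
        right parities as \<open>P\<close> is even; the two brackets then sum to
        \<open>P (br b c)\<close>.\<close>
      using bracket_mul_cancel[OF that P_mem P_mem] that by (simp add: P_br)
  qed
qed

end
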